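(* Let $\mathcal{H}_1,\mathcal{H}_2$ be complex separable Hilbert spaces, let $A:\operatorname{dom}(A)\subseteq\mathcal{H}_1\to\mathcal{H}_2$ be a densely defined, closed, linear operator with $\ker(A)=\{0\}$ and $\inf(\sigma(A^*A))=0$, and let $R$ be a densely defined, closable operator in $\mathcal{H}_1$ with $\operatorname{dom}(R)\cap\operatorname{dom}(R^* )\supseteq\operatorname{dom}(A)$. Then $$Q_{A,R}\big(I_{\mathcal{H}_1}\oplus[I_{\mathcal{H}_2}-P_{\ker(A^* )}]\big)=U_{\widetilde A}\,i\,G_{A,R}\,U_{\widetilde A}^{-1},$$ where the left-hand side is regarded as an operator in $\mathcal{H}_1\oplus\mathcal{K}_A$ (equality including domains).
   Context: $P_{\mathcal{M}}$ denotes the orthogonal projection onto a closed subspace $\mathcal{M}$. Under the hypotheses on $A$: - $\mathcal{H}_A$ is the Hilbert space completion of $\operatorname{dom}(A)$ with respect to the scalar product $(f,g)_A=(Af,Ag)_{\mathcal{H}_2}$; $\operatorname{dom}(A)$ is regarded as a dense subspace of $\mathcal{H}_A$. - $\mathcal{K}_A=\overline{\operatorname{ran}(A)}=\ker(A^* )^\perp\subseteq\mathcal{H}_2$. - $\widetilde A:\mathcal{H}_A\to\mathcal{K}_A$ is the unique unitary extension of the isometric map $\operatorname{dom}(A)\ni f\mapsto Af$. - $J_A:\mathcal{H}_1\supseteq\operatorname{dom}(A)\to\mathcal{H}_A$, $f\mapsto f$. - $U_{\widetilde A}=\begin{pmatrix}0&I_{\mathcal{H}_1}\\-i\widetilde A&0\end{pmatrix}:\mathcal{H}_A\oplus\mathcal{H}_1\to\mathcal{H}_1\oplus\mathcal{K}_A$,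 a unitary operator. - $G_{A,R}=\begin{pmatrix}0&J_A\\-A^*\widetilde A&-R\end{pmatrix}$ in $\mathcal{H}_A\oplus\mathcal{H}_1$ with $\operatorname{dom}(G_{A,R})=\operatorname{dom}(A^*\widetilde A)\oplus\operatorname{dom}(A)$, where $\operatorname{dom}(A^*\widetilde A)=\{f\in\mathcal{H}_A:\widetilde Af\in\operatorname{dom}(A^* )\}$. - $Q_{A,R}=\begin{pmatrix}-iR&A^*\\ A&0\end{pmatrix}$ in $\mathcal{H}_1\oplus\mathcal{H}_2$ with $\operatorname{dom}(Q_{A,R})=\operatorname{dom}(A)\oplus\operatorname{dom}(A^* )$. The operator $Q_{A,R}(I_{\mathcal{H}_1}\oplus[I_{\mathcal{H}_2}-P_{\ker(A^* )}])$ regarded in $\mathcal{H}_1\oplus\mathcal{K}_A$ is $(f,g)\mapsto(-iRf+A^*g,Af)$ on $\operatorname{dom}(A)\oplus(\operatorname{dom}(A^* )\cap\mathcal{K}_A)$. *)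

theory Defs
  imports "HOL-Analysis.Analysis"
begin

section \<open>Complex Hilbert spaces\<close>

text \<open>
  Scalar products are conjugate-linear in the first and linear in the second argument.
  The real vector space structure and the norm come from the superclass; positivity and
  definiteness of the scalar product follow from the last axiom, since norms are nonnegative.
\<close>

class complex_inner = real_normed_vector +
  fixes scaleC :: "complex \<Rightarrow> 'a \<Rightarrow> 'a"  (infixr \<open>*\<^sub>C\<close> 75)
    and cinner :: "'a \<Rightarrow> 'a \<Rightarrow> complex"
  assumes scaleC_add_right: "c *\<^sub>C (x + y) = c *\<^sub>C x + c *\<^sub>C y"
    and scaleC_add_left: "(c + d) *\<^sub>C x = c *\<^sub>C x + d *\<^sub>C x"
    and scaleC_scaleC: "c *\<^sub>C d *\<^sub>C x = (c * d) *\<^sub>C x"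
    and scaleC_of_real: "complex_of_real r *\<^sub>C x = r *\<^sub>R x"
    and cinner_commute: "cinner x y = cnj (cinner y x)"
    and cinner_add_right: "cinner x (y + z) = cinner x y + cinner x z"
    and cinner_scaleC_right: "cinner x (c *\<^sub>C y) = c * cinner x y"
    and norm_eq_sqrt_cinner: "norm x = sqrt (Re (cinner x x))"

class complex_hilbert = complex_inner + complete_space

text \<open>The orthogonal direct sum of two Hilbert spaces is their product type.\<close>

instantiation prod :: (complex_inner, complex_inner) complex_inner
begin

definition "scaleC c x = (c *\<^sub>C fst x, c *\<^sub>C snd x)"

definition "cinner x y = cinner (fst x) (fst y) + cinner (snd x) (snd y)"

instance
proof
  fix x y z :: "'a \<times> 'b" and c d :: complex and r :: real
  show "c *\<^sub>C (x + y) = c *\<^sub>C x + c *\<^sub>C y"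
    by (simp add: scaleC_prod_def scaleC_add_right)
  show "(c + d) *\<^sub>C x = c *\<^sub>C x + d *\<^sub>C x"
    by (simp add: scaleC_prod_def scaleC_add_left)
  show "c *\<^sub>C d *\<^sub>C x = (c * d) *\<^sub>C x"
    by (simp add: scaleC_prod_def scaleC_scaleC)
  show "complex_of_real r *\<^sub>C x = r *\<^sub>R x"
    by (simp add: scaleC_prod_def scaleC_of_real scaleR_prod_def)
  show "cinner x y = cnj (cinner y x)"
    using cinner_commute[of "fst x" "fst y"] cinner_commute[of "snd x" "snd y"]
    by (simp add: cinner_prod_def)
  show "cinner x (y + z) = cinner x y + cinner x z"
    by (simp add: cinner_prod_def cinner_add_right)
  show "cinner x (c *\<^sub>C y) = c * cinner x y"
    by (simp add: cinner_prod_def scaleC_prod_def cinner_scaleC_right distrib_left)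
  have nonneg: "0 \<le> Re (cinner u u)" for u :: "'u::complex_inner"
    using norm_ge_zero[of u] by (simp only: norm_eq_sqrt_cinner real_sqrt_ge_0_iff)
  show "norm x = sqrt (Re (cinner x x))"
    by (simp add: norm_prod_def cinner_prod_def norm_eq_sqrt_cinner[of "fst x"]
        norm_eq_sqrt_cinner[of "snd x"] nonneg)
qed

end

instance prod :: (complex_hilbert, complex_hilbert) complex_hilbert ..

text \<open>\<^term>\<open>M\<close> is a closed subspace in the intended use.\<close>

definition orth_proj :: "'a::complex_hilbert set \<Rightarrow> 'a \<Rightarrow> 'a" where
  "orth_proj M x = (THE p. p \<in> M \<and> (\<forall>m\<in>M. cinner m (x - p) = 0))"

definition unitary_onto :: "('a::complex_hilbert \<Rightarrow> 'b::complex_hilbert) \<Rightarrow> 'b set \<Rightarrow> bool" where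
  "unitary_onto U M \<longleftrightarrow>
     (\<forall>x y. U (x + y) = U x + U y) \<and> (\<forall>c x. U (c *\<^sub>C x) = c *\<^sub>C U x) \<and>
     (\<forall>x y. cinner (U x) (U y) = cinner x y) \<and> range U = M"


section \<open>Unbounded operators\<close>

text \<open>
  An operator is a partial map, whose domain is \<^const>\<open>dom\<close>. Equality of partial maps thus
  includes equality of domains, and \<^const>\<open>map_comp\<close> is the composition of operators with its
  natural domain.
\<close>

definition linear_op :: "('a::complex_hilbert \<rightharpoonup> 'b::complex_hilbert) \<Rightarrow> bool" where
  "linear_op T \<longleftrightarrow>
     T 0 = Some 0 \<and>
     (\<forall>f\<in>dom T. \<forall>g\<in>dom T. T (f + g) = Some (the (T f) + the (T g))) \<and>
     (\<forall>c. \<forall>f\<in>dom T. T (c *\<^sub>C f) = Some (c *\<^sub>C the (T f)))"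

definition densely_defined :: "('a::complex_hilbert \<rightharpoonup> 'b::complex_hilbert) \<Rightarrow> bool" where
  "densely_defined T \<longleftrightarrow> closure (dom T) = UNIV"

definition closed_op :: "('a::complex_hilbert \<rightharpoonup> 'b::complex_hilbert) \<Rightarrow> bool" where
  "closed_op T \<longleftrightarrow> closed (Map.graph T)"

definition closable_op :: "('a::complex_hilbert \<rightharpoonup> 'b::complex_hilbert) \<Rightarrow> bool" where
  "closable_op T \<longleftrightarrow> (\<exists>S. linear_op S \<and> closed_op S \<and> T \<subseteq>\<^sub>m S)"

definition op_kernel :: "('a::complex_hilbert \<rightharpoonup> 'b::complex_hilbert) \<Rightarrow> 'a set" where
  "op_kernel T = {f. T f = Some 0}"

text \<open>Meaningful for densely defined \<^term>\<open>T\<close>, where the vector \<^term>\<open>h\<close> is unique.\<close>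

definition adjoint_op :: "('a::complex_hilbert \<rightharpoonup> 'b::complex_hilbert) \<Rightarrow> ('b \<rightharpoonup> 'a)" where
  "adjoint_op T = (\<lambda>g.
     if \<exists>h. \<forall>f\<in>dom T. cinner (the (T f)) g = cinner f h
     then Some (THE h. \<forall>f\<in>dom T. cinner (the (T f)) g = cinner f h)
     else None)"

definition scale_op :: "complex \<Rightarrow> ('a::complex_hilbert \<rightharpoonup> 'b::complex_hilbert) \<Rightarrow> ('a \<rightharpoonup> 'b)" where
  "scale_op c T = (\<lambda>f. map_option (\<lambda>h. c *\<^sub>C h) (T f))"

text \<open>The inverse of an injective operator; its domain is the range of the operator.\<close>

definition inverse_op :: "('a::complex_hilbert \<rightharpoonup> 'b::complex_hilbert) \<Rightarrow> ('b \<rightharpoonup> 'a)" where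
  "inverse_op T = (\<lambda>g. if g \<in> ran T then Some (THE f. T f = Some g) else None)"

definition resolvent_set :: "('a::complex_hilbert \<rightharpoonup> 'a) \<Rightarrow> complex set" where
  "resolvent_set T = {z.
     bij_betw (\<lambda>f. the (T f) - z *\<^sub>C f) (dom T) UNIV \<and>
     bounded_linear (inv_into (dom T) (\<lambda>f. the (T f) - z *\<^sub>C f))}"

definition op_spectrum :: "('a::complex_hilbert \<rightharpoonup> 'a) \<Rightarrow> complex set" where
  "op_spectrum T = - resolvent_set T"


section \<open>The abstract damped wave equation\<close>

text \<open>
  The Hilbert space \<open>H\<^sub>A\<close> is given by its defining property: the type \<^typ>\<open>'c\<close> is complete, and
  \<open>J\<close>, which is the operator \<open>J\<^sub>A\<close>, embeds \<open>dom A\<close> linearly and densely in it, with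
  scalar product \<open>(Af, Ag)\<close>.
\<close>

definition is_completion ::
  "('a::complex_hilbert \<rightharpoonup> 'b::complex_hilbert) \<Rightarrow> ('a \<rightharpoonup> 'c::complex_hilbert) \<Rightarrow> bool" where
  "is_completion A J \<longleftrightarrow>
     linear_op J \<and> dom J = dom A \<and>
     (\<forall>f\<in>dom A. \<forall>g\<in>dom A. cinner (the (J f)) (the (J g)) = cinner (the (A f)) (the (A g))) \<and>
     closure (ran J) = UNIV"

definition K_space :: "('a::complex_hilbert \<rightharpoonup> 'b::complex_hilbert) \<Rightarrow> 'b set" where
  "K_space A = closure (ran A)"

definition A_tilde ::
  "('a::complex_hilbert \<rightharpoonup> 'b::complex_hilbert) \<Rightarrow> ('a \<rightharpoonup> 'c::complex_hilbert) \<Rightarrow> 'c \<Rightarrow> 'b" where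
  "A_tilde A J = (THE U. unitary_onto U (K_space A) \<and> (\<forall>f\<in>dom A. U (the (J f)) = the (A f)))"

definition U_op ::
  "('a::complex_hilbert \<rightharpoonup> 'b::complex_hilbert) \<Rightarrow> ('a \<rightharpoonup> 'c::complex_hilbert)
     \<Rightarrow> ('c \<times> 'a \<rightharpoonup> 'a \<times> 'b)" where
  "U_op A J = (\<lambda>(u, f). Some (f, - (\<i> *\<^sub>C A_tilde A J u)))"

definition G_op ::
  "('a::complex_hilbert \<rightharpoonup> 'b::complex_hilbert) \<Rightarrow> ('a \<rightharpoonup> 'a) \<Rightarrow> ('a \<rightharpoonup> 'c::complex_hilbert)
     \<Rightarrow> ('c \<times> 'a \<rightharpoonup> 'c \<times> 'a)" where
  "G_op A R J = (let B = adjoint_op A \<circ>\<^sub>m (Some \<circ> A_tilde A J) in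
     (\<lambda>(u, f). if u \<in> dom B \<and> f \<in> dom A
               then Some (the (J f), - the (B u) - the (R f)) else None))"

definition Q_op ::
  "('a::complex_hilbert \<rightharpoonup> 'b::complex_hilbert) \<Rightarrow> ('a \<rightharpoonup> 'a) \<Rightarrow> ('a \<times> 'b \<rightharpoonup> 'a \<times> 'b)" where
  "Q_op A R = (\<lambda>(f, g). if f \<in> dom A \<and> g \<in> dom (adjoint_op A)
     then Some (- (\<i> *\<^sub>C the (R f)) + the (adjoint_op A g), the (A f)) else None)"

text \<open>\<open>Q (I \<oplus> [I - P])\<close> in \<open>H\<^sub>1 \<oplus> H\<^sub>2\<close>, with \<open>P\<close> the projection onto the kernel of the adjoint of \<open>A\<close>.\<close>

definition Q_proj_op ::
  "('a::complex_hilbert \<rightharpoonup> 'b::complex_hilbert) \<Rightarrow> ('a \<rightharpoonup> 'a) \<Rightarrow> ('a \<times> 'b \<rightharpoonup> 'a \<times> 'b)" where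
  "Q_proj_op A R =
     Q_op A R \<circ>\<^sub>m (\<lambda>(f, g). Some (f, g - orth_proj (op_kernel (adjoint_op A)) g))"

end

theory Submission
  imports Defs
begin

text \<open>
  The isometry \<open>Jf \<mapsto> Af\<close> extends uniquely by continuity to a unitary map onto the closed
  range of \<open>A\<close>, so that the range of \<open>U\<close> is \<open>H\<^sub>1 \<oplus> K\<^sub>A\<close> and \<open>U\<^sup>-\<^sup>1 (f, g) = (u, f)\<close> where
  \<open>u\<close> is mapped to \<open>\<i>g\<close>. The factors \<open>\<i>\<close> and \<open>-\<i>\<close> then cancel on both components. On the left-hand
  side the projection onto \<open>ker A\<^sup>*\<close> vanishes on \<open>K\<^sub>A\<close>, since \<open>ker A\<^sup>*\<close> is orthogonal to the range
  of \<open>A\<close>.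
\<close>

section \<open>Scalar products\<close>

lemma scaleC_zero_right [simp]: "c *\<^sub>C (0::'a::complex_inner) = 0"
  using scaleC_add_right[of c 0 "0::'a"] by simp

lemma scaleC_minus1 [simp]: "(-1) *\<^sub>C (x::'a::complex_inner) = - x"
  using scaleC_of_real[of "-1" x] by simp

lemma scaleC_one [simp]: "1 *\<^sub>C (x::'a::complex_inner) = x"
  using scaleC_of_real[of 1 x] by simp

lemma scaleC_minus_right: "c *\<^sub>C (- x) = - (c *\<^sub>C (x::'a::complex_inner))"
  by (metis mult.commute scaleC_minus1 scaleC_scaleC)

lemma scaleC_diff_right: "c *\<^sub>C (x - y) = c *\<^sub>C x - c *\<^sub>C (y::'a::complex_inner)"
  using scaleC_add_right[of c x "- y"] by (simp add: scaleC_minus_right)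

lemma cinner_zero_right [simp]: "cinner x (0::'a::complex_inner) = 0"
  using cinner_add_right[of x 0 0] by simp

lemma cinner_minus_right: "cinner x (- y) = - cinner x (y::'a::complex_inner)"
  using cinner_scaleC_right[of x "-1" y] by simp

lemma cinner_diff_right: "cinner x (y - z) = cinner x y - cinner x (z::'a::complex_inner)"
  using cinner_add_right[of x y "- z"] by (simp add: cinner_minus_right)

lemma cinner_add_left: "cinner (x + y) z = cinner x z + cinner y (z::'a::complex_inner)"
  by (metis cinner_add_right cinner_commute complex_cnj_add)

lemma cinner_scaleC_left: "cinner (c *\<^sub>C x) y = cnj c * cinner x (y::'a::complex_inner)"
  by (metis cinner_scaleC_right cinner_commute complex_cnj_mult)

lemma Re_cinner_self: "Re (cinner x x) = (norm (x::'a::complex_inner))\<^sup>2"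
proof -
  \<comment> \<open>The real \<open>sqrt\<close> has the sign of its argument, so nonnegativity of
    the norm gives positivity of the scalar product.\<close>
  have "0 \<le> Re (cinner x x)"
    using norm_ge_zero[of x] by (simp only: norm_eq_sqrt_cinner real_sqrt_ge_0_iff)
  then show ?thesis
    by (simp add: norm_eq_sqrt_cinner)
qed

lemma cinner_self_eq_0_iff: "cinner x x = 0 \<longleftrightarrow> (x::'a::complex_inner) = 0"
  using Re_cinner_self[of x] by auto

lemma norm_scaleC: "norm (c *\<^sub>C (x::'a::complex_inner)) = cmod c * norm x"
proof -
  have "cinner (c *\<^sub>C x) (c *\<^sub>C x) = of_real ((cmod c)\<^sup>2) * cinner x x"
    by (simp add: cinner_scaleC_left cinner_scaleC_right complex_norm_square mult_ac
        del: of_real_power)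
  then have "(norm (c *\<^sub>C x))\<^sup>2 = (cmod c * norm x)\<^sup>2"
    by (simp flip: Re_cinner_self add: power_mult_distrib del: of_real_power)
  then show ?thesis
    by simp
qed

lemma bounded_linear_scaleC_right: "bounded_linear (\<lambda>x::'a::complex_inner. c *\<^sub>C x)"
proof
  show "c *\<^sub>C (x + y) = c *\<^sub>C x + c *\<^sub>C y" for x y :: 'a
    by (rule scaleC_add_right)
  show "c *\<^sub>C (r *\<^sub>R x) = r *\<^sub>R (c *\<^sub>C x)" for r and x :: 'a
    by (metis mult.commute scaleC_of_real scaleC_scaleC)
  show "\<exists>K. \<forall>x::'a. norm (c *\<^sub>C x) \<le> norm x * K"
    by (auto simp: norm_scaleC mult.commute intro: exI[of _ "cmod c"])
qed

lemmas continuous_on_scaleC_right [continuous_intros] =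
  bounded_linear.continuous_on[OF bounded_linear_scaleC_right]

text \<open>Expresses the scalar product through norms, whence its continuity. The sign of the
  imaginary part reflects linearity in the second argument:
  \<open>Re (cinner x (\<i> *\<^sub>C y))\<close> equals \<open>- Im (cinner x y)\<close>.\<close>

lemma polarization:
  fixes x y :: "'a::complex_inner"
  shows "cinner x y = Complex (((norm (x + y))\<^sup>2 - (norm x)\<^sup>2 - (norm y)\<^sup>2) / 2)
    (- ((norm (x + \<i> *\<^sub>C y))\<^sup>2 - (norm x)\<^sup>2 - (norm y)\<^sup>2) / 2)"
proof -
  have *: "(norm (u + v))\<^sup>2 - (norm u)\<^sup>2 - (norm v)\<^sup>2 = 2 * Re (cinner u v)" for u v :: 'a
    using arg_cong[OF cinner_commute[of u v], of Re]
    by (simp flip: Re_cinner_self add: cinner_add_left cinner_add_right)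
  show ?thesis
    using *[of x y] *[of x "\<i> *\<^sub>C y"]
    by (simp add: complex_eq_iff cinner_scaleC_right norm_scaleC)
qed

lemma continuous_on_cinner [continuous_intros]:
  assumes "continuous_on S f" and "continuous_on S g"
  shows "continuous_on S (\<lambda>x. cinner (f x) (g x :: 'a::complex_inner))"
  unfolding polarization Complex_eq using assms by (intro continuous_intros) auto

text \<open>Lets an identity between continuous functions be checked on a dense set only.\<close>

lemma dense_induct:
  assumes "closure S = UNIV" and "closed {x. P x}" and "\<And>x. x \<in> S \<Longrightarrow> P x"
  shows "P x"
  using closure_minimal[of S "{x. P x}"] assms by auto

section \<open>Extension of isometries\<close>

text \<open>An isometry is uniformly continuous and so extends to the closure of \<open>S\<close>;
  linearity and isometry survive by density. Only the values of \<open>V\<close> on \<open>S\<close>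
  matter.\<close>

lemma isometry_extension:
  fixes V :: "'c::complex_hilbert \<Rightarrow> 'b::complex_hilbert"
  assumes S_add: "\<And>x y. x \<in> S \<Longrightarrow> y \<in> S \<Longrightarrow> x + y \<in> S"
    and S_scale: "\<And>c x. x \<in> S \<Longrightarrow> c *\<^sub>C x \<in> S"
    and V_add: "\<And>x y. x \<in> S \<Longrightarrow> y \<in> S \<Longrightarrow> V (x + y) = V x + V y"
    and V_scale: "\<And>c x. x \<in> S \<Longrightarrow> V (c *\<^sub>C x) = c *\<^sub>C V x"
    and V_cinner: "\<And>x y. x \<in> S \<Longrightarrow> y \<in> S \<Longrightarrow> cinner (V x) (V y) = cinner x y"
    and dense: "closure S = UNIV"
  shows "\<exists>!U. unitary_onto U (closure (V ` S)) \<and> (\<forall>x\<in>S. U x = V x)"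
proof -
  have norm_unitary: "norm (U x) = norm x" if "\<forall>x y. cinner (U x) (U y) = cinner x y"
    for U :: "'c \<Rightarrow> 'b" and x
    using that by (simp add: norm_eq_sqrt_cinner)
  have bl: "bounded_linear U" if "unitary_onto U M" for U :: "'c \<Rightarrow> 'b" and M
  proof (rule bounded_linear_intro[where K = 1])
    show "U (r *\<^sub>R x) = r *\<^sub>R U x" for r x
      using that by (metis scaleC_of_real unitary_onto_def)
  qed (use that norm_unitary[of U] in \<open>auto simp: unitary_onto_def\<close>)
  have dist_V: "dist (V x) (V y) = dist x y" if "x \<in> S" "y \<in> S" for x y
  proof -
    have "V (x - y) = V x - V y"
      using V_add[OF that(1) S_scale[OF that(2), of "-1"]] V_scale[OF that(2), of "-1"] by simp
    moreover have "x - y \<in> S"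
      using S_add[OF that(1) S_scale[OF that(2), of "-1"]] by simp
    ultimately show ?thesis
      using V_cinner[of "x - y" "x - y"] by (simp add: dist_norm norm_eq_sqrt_cinner)
  qed
  have "uniformly_continuous_on S V"
    unfolding uniformly_continuous_on_def by (metis dist_V)
  then obtain U where "uniformly_continuous_on (closure S) U" and UV: "\<And>x. x \<in> S \<Longrightarrow> V x = U x"
    by (rule uniformly_continuous_on_extension_on_closure) auto
  then have contU: "continuous_on UNIV U"
    using dense uniformly_continuous_imp_continuous by metis
  have contU': "continuous_on T (\<lambda>x. U (f x))" if "continuous_on T f" for f :: "'x::topological_space \<Rightarrow> 'c" and T
    using continuous_on_compose2[OF contU that] by simp
  \<comment> \<open>Identities in two variables become identities in one pair, so that a single
    density argument covers both variables.\<close>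
  have SS: "closure (S \<times> S) = UNIV"
    by (simp add: closure_Times dense)
  have "U (fst p + snd p) = U (fst p) + U (snd p)" for p
    by (rule dense_induct[OF SS], intro closed_Collect_eq contU' continuous_intros)
      (use V_add S_add in \<open>auto simp flip: UV\<close>)
  then have "U (x + y) = U x + U y" for x y
    by (metis fst_conv snd_conv)
  moreover have "U (c *\<^sub>C x) = c *\<^sub>C U x" for c x
    by (rule dense_induct[OF dense], intro closed_Collect_eq contU' continuous_intros)
      (use V_scale S_scale in \<open>auto simp flip: UV\<close>)
  moreover have "cinner (U (fst p)) (U (snd p)) = cinner (fst p) (snd p)" for p
    by (rule dense_induct[OF SS], intro closed_Collect_eq contU' continuous_intros)
      (use V_cinner in \<open>auto simp flip: UV\<close>)
  then have U_cinner: "cinner (U x) (U y) = cinner x y" for x y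
    by (metis fst_conv snd_conv)
  ultimately have U: "unitary_onto U (range U)"
    by (simp add: unitary_onto_def)
  have "complete (range U)"
    using complete_isometric_image[OF zero_less_one subspace_UNIV bl[OF U]] norm_unitary[of U]
      U_cinner complete_UNIV by simp
  moreover have "V ` S \<subseteq> range U"
    using UV by auto
  ultimately have "closure (V ` S) \<subseteq> range U"
    by (simp add: closure_minimal complete_imp_closed)
  moreover have "range U \<subseteq> closure (V ` S)"
  proof -
    have "U ` S = V ` S"
      using UV by simp
    then have "U ` closure S \<subseteq> closure (V ` S)"
      using closure_bounded_linear_image_subset[OF bl[OF U], of S] by simp
    then show ?thesis
      by (simp add: dense)
  qed
  ultimately have "closure (V ` S) = range U"
    by (rule equalityI)
  then have "unitary_onto U (closure (V ` S)) \<and> (\<forall>x\<in>S. U x = V x)"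
    using U UV by simp
  \<comment> \<open>Uniqueness: unitary maps are continuous, and these two agree on a dense
    set.\<close>
  moreover have "U1 = U2"
    if "unitary_onto U1 M \<and> (\<forall>x\<in>S. U1 x = V x)" and "unitary_onto U2 M \<and> (\<forall>x\<in>S. U2 x = V x)"
    for U1 U2 M
  proof -
    have "U1 x = U2 x" for x
      by (rule dense_induct[OF dense], intro closed_Collect_eq linear_continuous_on)
        (use that bl in auto)
    then show ?thesis
      by blast
  qed
  ultimately show ?thesis
    by blast
qed

text \<open>\<open>A_tilde\<close> is a definite description; unique existence, obtained by
  extending \<open>Jf \<mapsto> Af\<close> from the range of \<open>J\<close>, makes its defining
  properties available.\<close>

lemma A_tilde_extends:
  assumes A: "linear_op A" and J: "is_completion A J"
  shows "unitary_onto (A_tilde A J) (K_space A)"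
    and "\<And>f. f \<in> dom A \<Longrightarrow> A_tilde A J (the (J f)) = the (A f)"
proof -
  define j where "j = (\<lambda>f. the (J f))"
  define a where "a = (\<lambda>f. the (A f))"
  \<comment> \<open>The map \<open>Jf \<mapsto> Af\<close> is written with an arbitrary choice of
    preimage under \<open>j\<close>; \<open>Vj\<close> below shows that the choice does not affect
    the value.\<close>
  define V where "V = (\<lambda>x. a (inv_into (dom A) j x))"
  define S where "S = j ` dom A"
  have dom_add: "f + g \<in> dom A" and a_add: "a (f + g) = a f + a g"
    if "f \<in> dom A" "g \<in> dom A" for f g
    using A that unfolding linear_op_def a_def by (metis domI option.sel)+
  have dom_scale: "c *\<^sub>C f \<in> dom A" and a_scale: "a (c *\<^sub>C f) = c *\<^sub>C a f"
    if "f \<in> dom A" for c f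
    using A that unfolding linear_op_def a_def by (metis domI option.sel)+
  have domJ: "dom J = dom A"
    using J by (simp add: is_completion_def)
  have linJ: "linear_op J"
    using J by (simp add: is_completion_def)
  have j_add: "j (f + g) = j f + j g" if "f \<in> dom A" "g \<in> dom A" for f g
    using linJ that domJ unfolding linear_op_def j_def by (metis option.sel)
  have j_scale: "j (c *\<^sub>C f) = c *\<^sub>C j f" if "f \<in> dom A" for c f
    using linJ that domJ unfolding linear_op_def j_def by (metis option.sel)
  have iso: "cinner (j f) (j g) = cinner (a f) (a g)" if "f \<in> dom A" "g \<in> dom A" for f g
    using J that by (simp add: is_completion_def j_def a_def)
  have Vj: "V (j f) = a f" if f: "f \<in> dom A" for f
  proof -
    define g where "g = inv_into (dom A) j (j f)"
    have g: "g \<in> dom A" "j g = j f"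
      unfolding g_def using f by (metis imageI inv_into_into, metis imageI f_inv_into_f)
    have m: "(-1) *\<^sub>C f \<in> dom A"
      using dom_scale f by blast
    \<comment> \<open>Two preimages of one vector differ by an element that \<open>j\<close> sends
      to zero; by \<open>iso\<close>, its image under \<open>a\<close> has norm zero.\<close>
    have "j (g + (-1) *\<^sub>C f) = 0"
      using j_add[OF g(1) m] j_scale[OF f, of "-1"] g(2) by simp
    then have "a (g + (-1) *\<^sub>C f) = 0"
      using iso[OF dom_add[OF g(1) m] dom_add[OF g(1) m]] cinner_self_eq_0_iff
      by (metis cinner_zero_right)
    then show ?thesis
      using a_add[OF g(1) m] a_scale[OF f, of "-1"] by (simp add: V_def g_def)
  qed
  have V: "\<exists>!U. unitary_onto U (closure (V ` S)) \<and> (\<forall>x\<in>S. U x = V x)"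
  proof (rule isometry_extension)
    have "ran J = S"
      using domJ by (force simp: S_def j_def ran_def image_def dom_def)
    then show "closure S = UNIV"
      using J by (simp add: is_completion_def)
    fix x assume "x \<in> S"
    then obtain f where f: "f \<in> dom A" "x = j f"
      by (auto simp: S_def)
    show "c *\<^sub>C x \<in> S" for c
      using f dom_scale j_scale by (metis S_def imageI)
    show "V (c *\<^sub>C x) = c *\<^sub>C V x" for c
      using f dom_scale[OF f(1), of c] j_scale[OF f(1), of c] a_scale[OF f(1), of c] Vj by metis
    fix y assume "y \<in> S"
    then obtain g where g: "g \<in> dom A" "y = j g"
      by (auto simp: S_def)
    have fg: "f + g \<in> dom A" "x + y = j (f + g)"
      using f g dom_add j_add by simp_all
    then show "x + y \<in> S"
      by (simp add: S_def)
    show "V (x + y) = V x + V y"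
      using f g fg Vj a_add by simp
    show "cinner (V x) (V y) = cinner x y"
      using f g Vj iso by simp
  qed
  have "V ` S = ran A"
    using Vj by (force simp: S_def a_def ran_def image_def dom_def)
  moreover have "(\<forall>x\<in>S. U x = V x) \<longleftrightarrow> (\<forall>f\<in>dom A. U (the (J f)) = the (A f))" for U
    using Vj by (simp add: S_def a_def j_def)
  ultimately have "\<exists>!U. unitary_onto U (K_space A) \<and> (\<forall>f\<in>dom A. U (the (J f)) = the (A f))"
    using V by (simp add: K_space_def)
  from theI'[OF this]
  show "unitary_onto (A_tilde A J) (K_space A)"
    and "\<And>f. f \<in> dom A \<Longrightarrow> A_tilde A J (the (J f)) = the (A f)"
    by (simp_all add: A_tilde_def)
qed

section \<open>The adjoint\<close>

text \<open>Density of the domain makes the representing vector unique, so the description in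
  \<open>adjoint_op\<close> can be replaced by its defining equation.\<close>

lemma adjoint_op_eq_Some_iff:
  fixes A :: "'a::complex_hilbert \<rightharpoonup> 'b::complex_hilbert"
  assumes "densely_defined A"
  shows "adjoint_op A g = Some h \<longleftrightarrow> (\<forall>f\<in>dom A. cinner (the (A f)) g = cinner f h)"
proof -
  have unique: "h1 = h2" if *: "\<forall>f\<in>dom A. cinner f h1 = cinner f h2" for h1 h2
  proof -
    have "cinner f (h1 - h2) = 0" for f
    proof (rule dense_induct[of "dom A" "\<lambda>f. cinner f (h1 - h2) = 0"])
      show "closure (dom A) = UNIV"
        using assms by (simp add: densely_defined_def)
      show "closed {f. cinner f (h1 - h2) = 0}"
        by (intro closed_Collect_eq continuous_intros)
      show "cinner f (h1 - h2) = 0" if "f \<in> dom A" for f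
        using that * by (simp add: cinner_diff_right)
    qed
    \<comment> \<open>The difference is orthogonal to every vector, in particular to itself.\<close>
    from this[of "h1 - h2"] show ?thesis
      by (simp add: cinner_self_eq_0_iff)
  qed
  have the: "(THE h. \<forall>f\<in>dom A. cinner (the (A f)) g = cinner f h) = h'"
    if "\<forall>f\<in>dom A. cinner (the (A f)) g = cinner f h'" for h'
    using that by (intro the_equality) (auto intro: unique)
  show ?thesis
  proof
    assume Some: "adjoint_op A g = Some h"
    then obtain h' where h': "\<forall>f\<in>dom A. cinner (the (A f)) g = cinner f h'"
      unfolding adjoint_op_def by (metis option.distinct(1))
    then have "adjoint_op A g = Some h'"
      unfolding adjoint_op_def the[OF h'] by auto
    with Some h' show "\<forall>f\<in>dom A. cinner (the (A f)) g = cinner f h"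
      by simp
  next
    assume h: "\<forall>f\<in>dom A. cinner (the (A f)) g = cinner f h"
    then show "adjoint_op A g = Some h"
      unfolding adjoint_op_def the[OF h] by auto
  qed
qed

lemma adjoint_op_scaleC:
  assumes "densely_defined A" and "adjoint_op A g = Some h"
  shows "adjoint_op A (c *\<^sub>C g) = Some (c *\<^sub>C h)"
  using assms by (simp add: adjoint_op_eq_Some_iff cinner_scaleC_right)

text \<open>Orthogonality of the kernel to the range of \<open>A\<close> passes to the closure by
  continuity of the scalar product, so zero meets the description of the projection.\<close>

lemma orth_proj_kernel_adjoint:
  assumes "densely_defined A" and g: "g \<in> K_space A"
  shows "orth_proj (op_kernel (adjoint_op A)) g = 0"
proof -
  have orth: "cinner m g = 0" if "m \<in> op_kernel (adjoint_op A)" for m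
  proof -
    have "\<forall>f\<in>dom A. cinner (the (A f)) m = 0"
      using that assms(1) by (simp add: op_kernel_def adjoint_op_eq_Some_iff)
    then have "ran A \<subseteq> {h. cinner m h = 0}"
      by (force simp: ran_def dom_def cinner_commute[of m])
    moreover have "closed {h. cinner m h = 0}"
      by (intro closed_Collect_eq continuous_intros)
    ultimately show ?thesis
      using g closure_minimal unfolding K_space_def by blast
  qed
  have "0 \<in> op_kernel (adjoint_op A)"
    using assms(1) by (simp add: op_kernel_def adjoint_op_eq_Some_iff)
  \<comment> \<open>For uniqueness, the candidate \<open>p\<close> itself is a sufficient test
    vector.\<close>
  moreover have "p = 0" if "p \<in> op_kernel (adjoint_op A)" and "cinner p (g - p) = 0" for p
    using that orth[of p] by (simp add: cinner_diff_right cinner_self_eq_0_iff)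
  ultimately show ?thesis
    unfolding orth_proj_def using orth by (intro the_equality) auto
qed

section \<open>The unitary equivalence\<close>

text \<open>\<open>U_op\<close> takes values in the full second space, so its inverse is undefined
  off \<open>K_space A\<close>; elsewhere it is found by solving for each component.\<close>

lemma inverse_U_op:
  assumes At: "unitary_onto (A_tilde A J) (K_space A)"
  shows "g \<notin> K_space A \<Longrightarrow> inverse_op (U_op A J) (f, g) = None"
    and "A_tilde A J u = \<i> *\<^sub>C g \<Longrightarrow> inverse_op (U_op A J) (f, g) = Some (u, f)"
proof -
  let ?T = "A_tilde A J"
  have scale: "?T (c *\<^sub>C x) = c *\<^sub>C ?T x" for c x
    using At by (simp add: unitary_onto_def)
  have U_iff: "U_op A J p = Some (f, g) \<longleftrightarrow> snd p = f \<and> ?T (fst p) = \<i> *\<^sub>C g" for p f g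
  proof -
    have "- (\<i> *\<^sub>C x) = g \<longleftrightarrow> x = \<i> *\<^sub>C g" for x
      by (auto simp: scaleC_minus_right scaleC_scaleC)
    then show ?thesis
      by (auto simp: U_op_def split_beta)
  qed
  {
    assume "g \<notin> K_space A"
    moreover have "g \<in> K_space A" if "?T v = \<i> *\<^sub>C g" for v
    proof -
      \<comment> \<open>The range of \<open>?T\<close> is closed under complex scalars, so it
        contains \<open>g\<close> along with \<open>\<i> *\<^sub>C g\<close>.\<close>
      have "?T ((- \<i>) *\<^sub>C v) = g"
        using that by (simp add: scale scaleC_scaleC)
      then show ?thesis
        using At unfolding unitary_onto_def by (metis rangeI)
    qed
    ultimately show "inverse_op (U_op A J) (f, g) = None"
      by (auto simp: inverse_op_def ran_def U_iff)
  }
  assume u: "?T u = \<i> *\<^sub>C g"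
  \<comment> \<open>Injectivity follows from isometry applied to \<open>v - u\<close>.\<close>
  have "v = u" if "?T v = ?T u" for v
  proof -
    have "?T (v + (-1) *\<^sub>C u) = ?T v + (-1) *\<^sub>C ?T u"
      using At by (metis unitary_onto_def)
    then have "?T (v - u) = 0"
      using that by simp
    moreover have "cinner (?T (v - u)) (?T (v - u)) = cinner (v - u) (v - u)"
      using At by (metis unitary_onto_def)
    ultimately have "cinner (v - u) (v - u) = 0"
      by simp
    then show ?thesis
      by (simp add: cinner_self_eq_0_iff)
  qed
  then have "U_op A J p = Some (f, g) \<longleftrightarrow> p = (u, f)" for p
    using u by (metis U_iff prod.collapse fst_conv snd_conv)
  then show "inverse_op (U_op A J) (f, g) = Some (u, f)"
    by (simp add: inverse_op_def ran_def)
qed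

theorem theorem5p7:
  fixes A :: "'a::complex_hilbert \<rightharpoonup> 'b::complex_hilbert"
    and R :: "'a \<rightharpoonup> 'a"
    and J :: "'a \<rightharpoonup> 'c::complex_hilbert"
  assumes "separable_space (euclidean :: 'a topology)"
    and "separable_space (euclidean :: 'b topology)"
    and "linear_op A" and "densely_defined A" and "closed_op A"
    and "op_kernel A = {0}"
    and "(INF z \<in> op_spectrum (adjoint_op A \<circ>\<^sub>m A). ereal (Re z)) = 0"
    and "linear_op R" and "densely_defined R" and "closable_op R"
    and "dom A \<subseteq> dom R \<inter> dom (adjoint_op R)"
    and "is_completion A J"
  shows "Q_proj_op A R |` (UNIV \<times> K_space A) =
    U_op A J \<circ>\<^sub>m scale_op \<i> (G_op A R J) \<circ>\<^sub>m inverse_op (U_op A J)"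
proof (rule ext, clarify)
  fix f g
  let ?T = "A_tilde A J"
  note T = A_tilde_extends[OF \<open>linear_op A\<close> \<open>is_completion A J\<close>]
  show "(Q_proj_op A R |` (UNIV \<times> K_space A)) (f, g) =
    (U_op A J \<circ>\<^sub>m scale_op \<i> (G_op A R J) \<circ>\<^sub>m inverse_op (U_op A J)) (f, g)"
  proof (cases "g \<in> K_space A")
    \<comment> \<open>Here both sides are undefined: the left by restriction, the right because the
      inverse is.\<close>
    case False
    then show ?thesis
      using inverse_U_op(1)[OF T(1)] by (simp add: map_comp_def)
  next
    case True
    then obtain v where "?T v = g"
      using T(1) by (metis imageE unitary_onto_def)
    then have u: "?T (\<i> *\<^sub>C v) = \<i> *\<^sub>C g"
      using T(1) by (simp add: unitary_onto_def)
    have lhs: "(Q_proj_op A R |` (UNIV \<times> K_space A)) (f, g) = Q_op A R (f, g)"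
      using True orth_proj_kernel_adjoint[OF \<open>densely_defined A\<close>]
      by (simp add: Q_proj_op_def map_comp_def)
    have inv: "inverse_op (U_op A J) (f, g) = Some (\<i> *\<^sub>C v, f)"
      using inverse_U_op(2)[OF T(1) u] .
    show ?thesis
    proof (cases "adjoint_op A g")
      case None
      \<comment> \<open>The right-hand side tests \<open>\<i> *\<^sub>C g\<close> rather than
        \<open>g\<close> for membership in the domain of the adjoint; scaling by
        \<open>- \<i>\<close> shows that the tests agree.\<close>
      have "adjoint_op A (\<i> *\<^sub>C g) = None"
      proof (rule ccontr)
        assume "adjoint_op A (\<i> *\<^sub>C g) \<noteq> None"
        then obtain h where "adjoint_op A (\<i> *\<^sub>C g) = Some h"
          by auto
        from adjoint_op_scaleC[OF \<open>densely_defined A\<close> this, of "- \<i>"] None show False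
          by (simp add: scaleC_scaleC)
      qed
      with None show ?thesis
        by (simp add: lhs inv map_comp_def Q_op_def G_op_def scale_op_def u domIff)
    next
      case (Some h)
      note ih = adjoint_op_scaleC[OF \<open>densely_defined A\<close> Some, of \<i>]
      show ?thesis
      proof (cases "f \<in> dom A")
        case False
        then show ?thesis
          by (simp add: lhs inv map_comp_def Q_op_def G_op_def scale_op_def)
      next
        case True
        \<comment> \<open>With \<open>h\<close> the adjoint at \<open>g\<close>, the operator
          \<open>\<i> G\<close> sends \<open>(\<i> v, f)\<close> to
          \<open>(\<i> Jf, \<i> (- \<i> h - Rf))\<close>. Then \<open>U_op\<close> swaps the
          components, giving \<open>h - \<i> Rf\<close> first and
          \<open>- \<i> (\<i> Af) = Af\<close> second.\<close>
        have "?T (\<i> *\<^sub>C the (J f)) = \<i> *\<^sub>C the (A f)"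
          using T True by (simp add: unitary_onto_def)
        moreover have "U_op A J (u, k) = Some (k, - (\<i> *\<^sub>C ?T u))" for u k
          by (simp add: U_op_def)
        ultimately show ?thesis
          using True Some ih
          by (simp add: lhs inv map_comp_def Q_op_def G_op_def scale_op_def u domIff
              scaleC_prod_def scaleC_diff_right scaleC_minus_right scaleC_scaleC)
      qed
    qed
  qed
qed

end
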